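(* Consider an eigenvalue problem $Ax = \lambda x$ where $A \in \mathbb{R}^{n\times n}$ is symmetric. Let $E \in \mathbb{R}^{n\times k}$ be a coding matrix with Kruskal row rank $k$. Let $R = AE$, $S = E^{T}AE$, and $T = E^{T}E$. Suppose there are $k$ faults, which result in the loss of $k$ rows and columns of $A$. Without loss of generality, the problem is permuted so that these are the last $k$ rows and columns, that is, $$A = \begin{bmatrix} C & F_1 \\ F_1^{T} & F_2^{T} \end{bmatrix},$$ where $C \in \mathbb{R}^{(n-k)\times(n-k)}$ consists of the non-lost rows and columns. Let $$E = \begin{bmatrix} E_C \\ E_F \end{bmatrix} \quad\text{and}\quad R = \begin{bmatrix} R_C \\ R_F \end{bmatrix}$$ be the partitions of $E$ and $R$ into the same set of correct (first $n-k$) and faulty (last $k$) rows. Then the generalized eigenvalues of $A' y = \lambda' B' y$, that is, of $$\begin{bmatrix} C & R_C \\ R_C^{T} & S \end{bmatrix}\begin{bmatrix} c \\ r \end{bmatrix} = \lambda' \begin{bmatrix} I & E_C \\ E_C^{T} & T \end{bmatrix}\begin{bmatrix} c \\ r \end{bmatrix},$$ are identical to those of $A$. Also, the eigenvectors are related by a simple linear transformation.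
   Context: A matrix has Kruskal row rank $k$ if any subset of $k$ of its rows is linearly independent. In the generalized problem, $A'$ and $B'$ are the displayed $n\times n$ block matrices on the left and right respectively, $I$ is the $(n-k)\times(n-k)$ identity matrix, and $y = \begin{bmatrix} c \\ r \end{bmatrix}$ with $c$ of length $n-k$ and $r$ of length $k$. A generalized eigenvalue of $A'y = \lambda' B'y$ is a scalar $\lambda'$ for which there is a nonzero vector $y$ (a generalized eigenvector) satisfying this equation. The eigenvectors referred to are those of $A$ and the generalized eigenvectors of $A'y = \lambda' B'y$. *)

theory Defs
  imports
    "Jordan_Normal_Form.Char_Poly"
    "Jordan_Normal_Form.VS_Connect"
begin

(* The library's lin_dep speaks about sets of vectors.  Injectivity of the row map on I makes the
   condition one about families, so that two equal rows at different positions count as dependent. *)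
definition kruskal_row_rank :: "'a::field mat \<Rightarrow> nat \<Rightarrow> bool" where
  "kruskal_row_rank M k \<longleftrightarrow>
     (\<forall>I \<subseteq> {..<dim_row M}. card I = k \<longrightarrow>
        inj_on (row M) I \<and>
        \<not> module.lin_dep class_ring (module_vec TYPE('a) (dim_col M)) (row M ` I))"

definition generalized_eigenvector ::
    "'a::comm_ring_1 mat \<Rightarrow> 'a mat \<Rightarrow> 'a vec \<Rightarrow> 'a \<Rightarrow> bool" where
  "generalized_eigenvector P Q y l \<longleftrightarrow>
     y \<in> carrier_vec (dim_row P) \<and> y \<noteq> 0\<^sub>v (dim_row P) \<and> P *\<^sub>v y = l \<cdot>\<^sub>v (Q *\<^sub>v y)"

definition generalized_eigenvalue ::
    "'a::comm_ring_1 mat \<Rightarrow> 'a mat \<Rightarrow> 'a \<Rightarrow> bool" where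
  "generalized_eigenvalue P Q l \<longleftrightarrow> (\<exists>y. generalized_eigenvector P Q y l)"

end

theory Submission
  imports Defs "Jordan_Normal_Form.DL_Rank"
begin

text \<open>
  With \<open>M = [I, E\<^sub>C; 0, E\<^sub>F]\<close> one has \<open>A' = M\<^sup>T A M\<close> and \<open>B' = M\<^sup>T M\<close>: the two problems are
  congruent. The rows of \<open>E\<^sub>F\<close> are \<open>k\<close> rows of \<open>E\<close>, hence independent, so \<open>M\<close> is invertible;
  cancelling \<open>M\<^sup>T\<close> in \<open>M\<^sup>T A M y = \<lambda> M\<^sup>T M y\<close> leaves \<open>A (M y) = \<lambda> (M y)\<close>.
\<close>

section \<open>Block matrices and stacked rows\<close>

lemma four_block_mat_inject:
  assumes "A1 \<in> carrier_mat nr1 nc1" "B1 \<in> carrier_mat nr1 nc2"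
      "C1 \<in> carrier_mat nr2 nc1" "D1 \<in> carrier_mat nr2 nc2"
    and "A2 \<in> carrier_mat nr1 nc1" "B2 \<in> carrier_mat nr1 nc2"
      "C2 \<in> carrier_mat nr2 nc1" "D2 \<in> carrier_mat nr2 nc2"
    and eq: "four_block_mat A1 B1 C1 D1 = four_block_mat A2 B2 C2 D2"
  shows "A1 = A2 \<and> B1 = B2 \<and> C1 = C2 \<and> D1 = D2"
proof -
  have ix: "four_block_mat A1 B1 C1 D1 $$ (i, j) = four_block_mat A2 B2 C2 D2 $$ (i, j)" for i j
    using eq by simp
  have "A1 = A2"
  proof (rule eq_matI)
    fix i j assume "i < dim_row A2" "j < dim_col A2"
    then show "A1 $$ (i, j) = A2 $$ (i, j)" using ix[of i j] assms(1-8) by simp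
  qed (use assms in auto)
  moreover have "B1 = B2"
  proof (rule eq_matI)
    fix i j assume "i < dim_row B2" "j < dim_col B2"
    then show "B1 $$ (i, j) = B2 $$ (i, j)" using ix[of i "nc1 + j"] assms(1-8) by simp
  qed (use assms in auto)
  moreover have "C1 = C2"
  proof (rule eq_matI)
    fix i j assume "i < dim_row C2" "j < dim_col C2"
    then show "C1 $$ (i, j) = C2 $$ (i, j)" using ix[of "nr1 + i" j] assms(1-8) by simp
  qed (use assms in auto)
  moreover have "D1 = D2"
  proof (rule eq_matI)
    fix i j assume "i < dim_row D2" "j < dim_col D2"
    then show "D1 $$ (i, j) = D2 $$ (i, j)" using ix[of "nr1 + i" "nc1 + j"] assms(1-8) by simp
  qed (use assms in auto)
  ultimately show ?thesis by simp
qed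

text \<open>Stacking is a four-block matrix whose two right-hand blocks have width 0, so blocks can
  be compared as above; the empty blocks agree trivially.\<close>

lemma append_rows_inject:
  assumes "A1 \<in> carrier_mat nr1 nc" "B1 \<in> carrier_mat nr2 nc"
    and "A2 \<in> carrier_mat nr1 nc" "B2 \<in> carrier_mat nr2 nc"
    and "A1 @\<^sub>r B1 = A2 @\<^sub>r B2"
  shows "A1 = A2 \<and> B1 = B2"
  using four_block_mat_inject[of A1 nr1 nc "0\<^sub>m nr1 0" 0 B1 nr2 "0\<^sub>m nr2 0"
      A2 "0\<^sub>m nr1 0" B2 "0\<^sub>m nr2 0"] assms
  by (auto simp: append_rows_def)

lemma four_block_mat_mult_append_rows:
  fixes A :: "'a::semiring_0 mat"
  assumes "A \<in> carrier_mat nr1 n1" "B \<in> carrier_mat nr1 n2"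
      "C \<in> carrier_mat nr2 n1" "D \<in> carrier_mat nr2 n2"
    and "U \<in> carrier_mat n1 nc" "V \<in> carrier_mat n2 nc"
  shows "four_block_mat A B C D * (U @\<^sub>r V) = (A * U + B * V) @\<^sub>r (C * U + D * V)"
proof -
  have "four_block_mat A B C D * four_block_mat U (0\<^sub>m n1 0) V (0\<^sub>m n2 0)
      = four_block_mat (A * U + B * V) (A * 0\<^sub>m n1 0 + B * 0\<^sub>m n2 0)
          (C * U + D * V) (C * 0\<^sub>m n1 0 + D * 0\<^sub>m n2 0)"
    by (rule mult_four_block_mat[OF assms(1-4)]) (use assms in auto)
  then show ?thesis using assms by (simp add: append_rows_def)
qed

lemma transpose_append_rows_mult_append_rows:
  fixes U1 :: "'a::comm_semiring_0 mat"
  assumes "U1 \<in> carrier_mat n1 nr" "V1 \<in> carrier_mat n2 nr"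
    and "U2 \<in> carrier_mat n1 nc" "V2 \<in> carrier_mat n2 nc"
  shows "(U1 @\<^sub>r V1)\<^sup>T * (U2 @\<^sub>r V2) = U1\<^sup>T * U2 + V1\<^sup>T * V2"
proof -
  have "(U1 @\<^sub>r V1)\<^sup>T = four_block_mat U1\<^sup>T V1\<^sup>T (0\<^sub>m 0 n1) (0\<^sub>m 0 n2)"
    using assms unfolding append_rows_def
    by (subst transpose_four_block_mat[where ?nr1.0 = n1 and ?nr2.0 = n2]) auto
  \<comment> \<open>Transposition has turned the columns of width 0 into rows of height 0. The
    product is therefore stacked on a matrix without rows, which the next step drops.\<close>
  then have "(U1 @\<^sub>r V1)\<^sup>T * (U2 @\<^sub>r V2)
      = (U1\<^sup>T * U2 + V1\<^sup>T * V2) @\<^sub>r (0\<^sub>m 0 n1 * U2 + 0\<^sub>m 0 n2 * V2)"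
    using assms by (simp add: four_block_mat_mult_append_rows[where ?nr2.0 = 0])
  also have "\<dots> = U1\<^sup>T * U2 + V1\<^sup>T * V2"
    using assms by (intro eq_matI) (auto simp: append_rows_def)
  finally show ?thesis .
qed

section \<open>Independence of the faulty rows of the coding matrix\<close>

lemma kruskal_row_rank_imp_det_nonzero:
  fixes U :: "'a::field mat"
  assumes U: "U \<in> carrier_mat m k" and V: "V \<in> carrier_mat k k"
    and kr: "kruskal_row_rank (U @\<^sub>r V) k"
  shows "det V \<noteq> 0"
proof -
  interpret vec_space "TYPE('a)" k .
  let ?E = "U @\<^sub>r V" and ?I = "{m..<m + k}"
  have E: "?E \<in> carrier_mat (m + k) k" using U V by auto
  have row: "row ?E (m + i) = row V i" if "i < k" for i
    using that U V by (intro eq_vecI) (auto simp: append_rows_def)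
  \<comment> \<open>\<open>?I\<close> indexes the last \<open>k\<close> rows of the stack, which are
    exactly the rows of \<open>V\<close>; the Kruskal condition is applied to this one index
    set.\<close>
  have "inj_on (row ?E) ?I \<and> lin_indpt (row ?E ` ?I)"
    using kr[unfolded kruskal_row_rank_def, rule_format, of ?I] E
    by (simp add: subset_iff)
  then have inj: "inj_on (row ?E) ?I" and ind: "lin_indpt (row ?E ` ?I)" by auto
  have I: "?I = (+) m ` {..<k}"
    using image_add_atLeastLessThan[of m 0 k] by (simp add: lessThan_atLeast0 add.commute)
  have cols: "cols V\<^sup>T = map (row V) [0..<k]" using V by (simp add: rows_def)
  have "row ?E ` ?I = row V ` {..<k}"
    unfolding I image_image using row by (intro image_cong) auto
  then have ind': "lin_indpt (set (cols V\<^sup>T))"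
    using ind unfolding cols by (simp add: atLeast0LessThan)
  \<comment> \<open>Independence of a set of vectors is blind to repeated rows. Full rank also
    requires distinct rows, and injectivity of the row map supplies this.\<close>
  have "inj_on (row V) {..<k}"
  proof (rule inj_onI)
    fix i j assume "i \<in> {..<k}" "j \<in> {..<k}" "row V i = row V j"
    then show "i = j" using inj_onD[OF inj, of "m + i" "m + j"] row by simp
  qed
  then have "distinct (cols V\<^sup>T)"
    unfolding cols by (simp add: distinct_map atLeast0LessThan)
  \<comment> \<open>The rank is the dimension of the column span, so it is taken of the transpose,
    which has the same determinant as \<open>V\<close>.\<close>
  then have "rank V\<^sup>T = k" using lin_indpt_full_rank[of "V\<^sup>T" k] ind' V by auto
  then show ?thesis using det_rank_iff[of "V\<^sup>T"] det_transpose[OF V] V by auto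
qed

section \<open>Congruence of generalized eigenproblems\<close>

lemma det_nonzero_imp_inverse:
  fixes M :: "'a::field mat"
  assumes "M \<in> carrier_mat n n" "det M \<noteq> 0"
  obtains N where "N \<in> carrier_mat n n" "M * N = 1\<^sub>m n" "N * M = 1\<^sub>m n"
  using det_non_zero_imp_unit[OF assms, of "()"] by (auto simp: Units_def ring_mat_def)

lemma mult_mat_vec_smult:
  fixes A :: "'a::comm_ring_1 mat"
  assumes "A \<in> carrier_mat nr nc" "v \<in> carrier_vec nc"
  shows "A *\<^sub>v (c \<cdot>\<^sub>v v) = c \<cdot>\<^sub>v (A *\<^sub>v v)"
  using assms by (intro eq_vecI) (auto simp: scalar_prod_smult_right)

text \<open>Multiplying by \<open>N\<^sup>T\<close> cancels \<open>M\<^sup>T\<close> from the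
  equation, and multiplying by \<open>N\<close> shows that \<open>M\<close> sends only 0 to 0. The
  inverse is given as an explicit \<open>N\<close> because over a commutative ring a nonzero
  determinant does not ensure one.\<close>

lemma generalized_eigenvector_congruence:
  fixes A M N :: "'a::comm_ring_1 mat"
  assumes A: "A \<in> carrier_mat n n" and M: "M \<in> carrier_mat n n" and N: "N \<in> carrier_mat n n"
    and MN: "M * N = 1\<^sub>m n" and NM: "N * M = 1\<^sub>m n" and y: "y \<in> carrier_vec n"
  shows "generalized_eigenvector (M\<^sup>T * A * M) (M\<^sup>T * M) y l \<longleftrightarrow> eigenvector A (M *\<^sub>v y) l"
proof -
  have My: "M *\<^sub>v y \<in> carrier_vec n" using M y by auto
  have inv: "N *\<^sub>v (M *\<^sub>v y) = y" using NM M N y by (simp flip: assoc_mult_mat_vec)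
  have "N\<^sup>T * M\<^sup>T = 1\<^sub>m n" using MN M N by (simp flip: transpose_mult)
  then have invT: "N\<^sup>T *\<^sub>v (M\<^sup>T *\<^sub>v v) = v" if "v \<in> carrier_vec n" for v
    using M N that by (simp flip: assoc_mult_mat_vec[where ?n\<^sub>1.0 = n and ?n\<^sub>2.0 = n and ?n\<^sub>3.0 = n])
  have cancel: "M\<^sup>T *\<^sub>v v = M\<^sup>T *\<^sub>v w \<longleftrightarrow> v = w"
    if "v \<in> carrier_vec n" "w \<in> carrier_vec n" for v w
    using that invT by metis
  have "(M\<^sup>T * A * M) *\<^sub>v y = M\<^sup>T *\<^sub>v (A *\<^sub>v (M *\<^sub>v y))"
    using A M y by (simp add: assoc_mult_mat_vec[where ?n\<^sub>1.0 = n and ?n\<^sub>2.0 = n and ?n\<^sub>3.0 = n])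
  moreover have "l \<cdot>\<^sub>v ((M\<^sup>T * M) *\<^sub>v y) = M\<^sup>T *\<^sub>v (l \<cdot>\<^sub>v (M *\<^sub>v y))"
    using M My y by (simp add: assoc_mult_mat_vec[where ?n\<^sub>1.0 = n and ?n\<^sub>2.0 = n and ?n\<^sub>3.0 = n]
        mult_mat_vec_smult[of "M\<^sup>T" n n])
  ultimately have "(M\<^sup>T * A * M) *\<^sub>v y = l \<cdot>\<^sub>v ((M\<^sup>T * M) *\<^sub>v y)
      \<longleftrightarrow> A *\<^sub>v (M *\<^sub>v y) = l \<cdot>\<^sub>v (M *\<^sub>v y)"
    using cancel A My by simp
  moreover have "M *\<^sub>v y = 0\<^sub>v n \<longleftrightarrow> y = 0\<^sub>v n" using inv M N by force
  ultimately show ?thesis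
    using A M y My unfolding generalized_eigenvector_def eigenvector_def by simp
qed

text \<open>The vectorwise equivalence makes \<open>M\<close> map one set of eigenvectors into the
  other, and \<open>N\<close> maps back: for an eigenvector \<open>x\<close>, the equivalence is
  read from right to left at \<open>N *\<^sub>v x\<close>, whose image under \<open>M\<close> is
  \<open>x\<close>.\<close>

lemma bij_betw_generalized_eigenvectors:
  fixes A M N :: "'a::comm_ring_1 mat"
  assumes A: "A \<in> carrier_mat n n" and M: "M \<in> carrier_mat n n" and N: "N \<in> carrier_mat n n"
    and MN: "M * N = 1\<^sub>m n" and NM: "N * M = 1\<^sub>m n"
  shows "bij_betw (\<lambda>y. M *\<^sub>v y) {y. generalized_eigenvector (M\<^sup>T * A * M) (M\<^sup>T * M) y l}
           {x. eigenvector A x l}"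
proof (rule bij_betw_byWitness[where f' = "\<lambda>x. N *\<^sub>v x"])
  have NMy: "N *\<^sub>v (M *\<^sub>v y) = y" if "y \<in> carrier_vec n" for y
    using NM M N that by (simp flip: assoc_mult_mat_vec)
  have MNx: "M *\<^sub>v (N *\<^sub>v x) = x" if "x \<in> carrier_vec n" for x
    using MN M N that by (simp flip: assoc_mult_mat_vec)
  have carrier_y: "y \<in> carrier_vec n"
    if "generalized_eigenvector (M\<^sup>T * A * M) (M\<^sup>T * M) y l" for y
    using that M unfolding generalized_eigenvector_def by simp
  have carrier_x: "x \<in> carrier_vec n" if "eigenvector A x l" for x
    using that A unfolding eigenvector_def by simp
  note congr = generalized_eigenvector_congruence[OF A M N MN NM]
  show "\<forall>y\<in>{y. generalized_eigenvector (M\<^sup>T * A * M) (M\<^sup>T * M) y l}. N *\<^sub>v (M *\<^sub>v y) = y"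
    using carrier_y NMy by blast
  show "\<forall>x\<in>{x. eigenvector A x l}. M *\<^sub>v (N *\<^sub>v x) = x"
    using carrier_x MNx by blast
  show "(\<lambda>y. M *\<^sub>v y) ` {y. generalized_eigenvector (M\<^sup>T * A * M) (M\<^sup>T * M) y l}
      \<subseteq> {x. eigenvector A x l}"
    using carrier_y congr by blast
  show "(\<lambda>x. N *\<^sub>v x) ` {x. eigenvector A x l}
      \<subseteq> {y. generalized_eigenvector (M\<^sup>T * A * M) (M\<^sup>T * M) y l}"
  proof safe
    fix x assume x: "eigenvector A x l"
    have "N *\<^sub>v x \<in> carrier_vec n" using N carrier_x[OF x] by simp
    then show "generalized_eigenvector (M\<^sup>T * A * M) (M\<^sup>T * M) (N *\<^sub>v x) l"
      using congr x MNx[OF carrier_x[OF x]] by simp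
  qed
qed

section \<open>Spectral equivalence of the coded problem and the original one\<close>

theorem theorem3p3:
  fixes n k :: nat
    and A E R S T C F\<^sub>1 F\<^sub>2 E\<^sub>C E\<^sub>F R\<^sub>C R\<^sub>F A' B' M :: "real mat"
  assumes "k \<le> n"
    and "A \<in> carrier_mat n n"
    and "transpose_mat A = A"
    and "E \<in> carrier_mat n k"
    and "kruskal_row_rank E k"
    and "R = A * E"
    and "S = transpose_mat E * A * E"
    and "T = transpose_mat E * E"
    and "C \<in> carrier_mat (n - k) (n - k)"
    and "F\<^sub>1 \<in> carrier_mat (n - k) k"
    and "F\<^sub>2 \<in> carrier_mat k k"
    and "A = four_block_mat C F\<^sub>1 (transpose_mat F\<^sub>1) (transpose_mat F\<^sub>2)"
    and "E\<^sub>C \<in> carrier_mat (n - k) k"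
    and "E\<^sub>F \<in> carrier_mat k k"
    and "E = E\<^sub>C @\<^sub>r E\<^sub>F"
    and "R\<^sub>C \<in> carrier_mat (n - k) k"
    and "R\<^sub>F \<in> carrier_mat k k"
    and "R = R\<^sub>C @\<^sub>r R\<^sub>F"
    and "A' = four_block_mat C R\<^sub>C (transpose_mat R\<^sub>C) S"
    and "B' = four_block_mat (1\<^sub>m (n - k)) E\<^sub>C (transpose_mat E\<^sub>C) T"
    and "M = four_block_mat (1\<^sub>m (n - k)) E\<^sub>C (0\<^sub>m k (n - k)) E\<^sub>F"
  shows "{l :: 's::real_field. generalized_eigenvalue (map_mat of_real A') (map_mat of_real B') l}
           = {l :: 's. eigenvalue (map_mat of_real A) l}
       \<and> invertible_mat M
       \<and> (\<forall>l :: 's. bij_betw (\<lambda>y. map_mat of_real M *\<^sub>v y)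
            {y. generalized_eigenvector (map_mat of_real A') (map_mat of_real B') y l}
            {x. eigenvector (map_mat of_real A) x l})"
proof -
  note A = assms(2) and sym = assms(3) and C = assms(9) and F1 = assms(10) and F2 = assms(11)
    and Ablk = assms(12) and EC = assms(13) and EF = assms(14) and Eblk = assms(15)
    and RC = assms(16) and RF = assms(17) and Rblk = assms(18) and Mblk = assms(21)
  have n: "n - k + k = n" using \<open>k \<le> n\<close> by simp
  have M: "M \<in> carrier_mat n n"
    using four_block_carrier_mat[OF one_carrier_mat EF, of "n - k" E\<^sub>C "0\<^sub>m k (n - k)"] n
    unfolding Mblk by simp

  have "A\<^sup>T = four_block_mat C\<^sup>T F\<^sub>1 F\<^sub>1\<^sup>T F\<^sub>2"
    using C F1 F2 by (simp add: Ablk transpose_four_block_mat)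
  \<comment> \<open>Symmetry of \<open>C\<close> is what lets \<open>C\<close> itself, not
    \<open>C\<^sup>T\<close>, appear in the formula for \<open>R\<^sub>C\<^sup>T\<close>
    below.\<close>
  then have Csym: "C\<^sup>T = C"
    using four_block_mat_inject[of "C\<^sup>T" "n - k" "n - k" F\<^sub>1 k "F\<^sub>1\<^sup>T" k F\<^sub>2 C F\<^sub>1 "F\<^sub>1\<^sup>T" "F\<^sub>2\<^sup>T"]
      C F1 F2 sym Ablk by auto
  have "R\<^sub>C @\<^sub>r R\<^sub>F = (C * E\<^sub>C + F\<^sub>1 * E\<^sub>F) @\<^sub>r (F\<^sub>1\<^sup>T * E\<^sub>C + F\<^sub>2\<^sup>T * E\<^sub>F)"
    unfolding Rblk[symmetric] assms(6) unfolding Ablk Eblk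
    by (rule four_block_mat_mult_append_rows) (use C F1 F2 EC EF in auto)
  then have "R\<^sub>C = C * E\<^sub>C + F\<^sub>1 * E\<^sub>F \<and> R\<^sub>F = F\<^sub>1\<^sup>T * E\<^sub>C + F\<^sub>2\<^sup>T * E\<^sub>F"
    by (intro append_rows_inject[where nc = k]) (use C F1 F2 EC EF RC RF in auto)
  then have RC_eq: "R\<^sub>C = C * E\<^sub>C + F\<^sub>1 * E\<^sub>F" and RF_eq: "R\<^sub>F = F\<^sub>1\<^sup>T * E\<^sub>C + F\<^sub>2\<^sup>T * E\<^sub>F"
    by auto
  have RCT: "R\<^sub>C\<^sup>T = E\<^sub>C\<^sup>T * C + E\<^sub>F\<^sup>T * F\<^sub>1\<^sup>T"
    unfolding RC_eq using C F1 EC EF Csym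
    by (simp add: transpose_add[where nr = "n - k" and nc = k] transpose_mult[where nr = "n - k" and nc = k])
  \<comment> \<open>Reassociation makes \<open>S\<close> a product of two stacked matrices, so it
    splits into a correct and a faulty contribution.\<close>
  have "S = E\<^sup>T * R"
    unfolding assms(6,7) using A assms(4) by (intro assoc_mult_mat[where ?n\<^sub>1.0 = k]) auto
  then have S: "S = E\<^sub>C\<^sup>T * R\<^sub>C + E\<^sub>F\<^sup>T * R\<^sub>F"
    using transpose_append_rows_mult_append_rows[OF EC EF RC RF] Eblk Rblk by simp
  have T: "T = E\<^sub>C\<^sup>T * E\<^sub>C + E\<^sub>F\<^sup>T * E\<^sub>F"
    using transpose_append_rows_mult_append_rows[OF EC EF EC EF] Eblk assms(8) by simp

  have MT: "M\<^sup>T = four_block_mat (1\<^sub>m (n - k)) (0\<^sub>m (n - k) k) E\<^sub>C\<^sup>T E\<^sub>F\<^sup>T"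
    using EC EF unfolding Mblk
    by (subst transpose_four_block_mat[where ?nr1.0 = "n - k" and ?nr2.0 = k]) auto
  \<comment> \<open>The first \<open>n - k\<close> columns of \<open>M\<close> are unit vectors and
    the last \<open>k\<close> are those of \<open>E\<close>. So \<open>A * M\<close> consists of the
    first \<open>n - k\<close> columns of \<open>A\<close> followed by \<open>R\<close>.\<close>
  have AM: "A * M = four_block_mat C R\<^sub>C F\<^sub>1\<^sup>T R\<^sub>F"
    unfolding Ablk Mblk RC_eq RF_eq using C F1 F2 EC EF
    by (subst mult_four_block_mat[where ?nr1.0 = "n - k" and ?nr2.0 = k and ?n1.0 = "n - k"
          and ?n2.0 = k and ?nc1.0 = "n - k" and ?nc2.0 = k]) auto
  \<comment> \<open>The upper blocks are kept, and the lower ones become the expressions found for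
    \<open>R\<^sub>C\<^sup>T\<close> and \<open>S\<close>.\<close>
  have "M\<^sup>T * (A * M) = A'"
    unfolding AM MT assms(19) RCT S using C F1 EC EF RC RF
    by (subst mult_four_block_mat[where ?nr1.0 = "n - k" and ?nr2.0 = k and ?n1.0 = "n - k"
          and ?n2.0 = k and ?nc1.0 = "n - k" and ?nc2.0 = k]) auto
  then have A': "A' = M\<^sup>T * A * M"
    using A M by (simp add: assoc_mult_mat[where ?n\<^sub>1.0 = n])
  have B': "B' = M\<^sup>T * M"
    unfolding MT unfolding Mblk assms(20) T using EC EF
    by (subst mult_four_block_mat[where ?nr1.0 = "n - k" and ?nr2.0 = k and ?n1.0 = "n - k"
          and ?n2.0 = k and ?nc1.0 = "n - k" and ?nc2.0 = k]) auto

  \<comment> \<open>\<open>M\<close> is block upper triangular with an identity as first diagonal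
    block.\<close>
  have "det M = det E\<^sub>F"
    unfolding Mblk using EC EF
    by (subst det_four_block_mat_lower_left_zero[where n = "n - k" and m = k]) auto
  then have "det M \<noteq> 0"
    using kruskal_row_rank_imp_det_nonzero[OF EC EF] assms(5) Eblk by simp
  then obtain N where N: "N \<in> carrier_mat n n" and MN: "M * N = 1\<^sub>m n" and NM: "N * M = 1\<^sub>m n"
    using det_nonzero_imp_inverse[OF M] by blast
  have "invertible_mat M"
    unfolding invertible_mat_def inverts_mat_def using M N MN NM by auto
  moreover have bij: "bij_betw (\<lambda>y. map_mat of_real M *\<^sub>v y)
      {y. generalized_eigenvector (map_mat of_real A') (map_mat of_real B') y l}
      {x. eigenvector (map_mat of_real A) x l}" for l :: 's
  proof -
    \<comment> \<open>The factorizations and the inverse are real. Since \<open>of_real\<close> is a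
      ring homomorphism, they carry over to every real field, in particular to the complex
      numbers.\<close>
    let ?h = "map_mat (of_real :: real \<Rightarrow> 's)"
    have "?h A' = (?h M)\<^sup>T * ?h A * ?h M" "?h B' = (?h M)\<^sup>T * ?h M"
      unfolding A' B' using A M
      by (simp_all add: of_real_hom.mat_hom_mult[where nr = n and n = n and nc = n] map_mat_transpose)
    moreover have "?h M * ?h N = 1\<^sub>m n" "?h N * ?h M = 1\<^sub>m n"
      using MN NM
      by (simp_all add: of_real_hom.mat_hom_one
          flip: of_real_hom.mat_hom_mult[OF M N] of_real_hom.mat_hom_mult[OF N M])
    ultimately show ?thesis
      using bij_betw_generalized_eigenvectors[of "?h A" n "?h M" "?h N" l] A M N by simp
  qed
  \<comment> \<open>A scalar is an eigenvalue iff its set of eigenvectors is nonempty, and the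
    bijection preserves nonemptiness.\<close>
  moreover have "generalized_eigenvalue (map_mat of_real A') (map_mat of_real B') l
      \<longleftrightarrow> eigenvalue (map_mat of_real A) l" for l :: 's
    using bij_betw_imp_surj_on[OF bij[of l]]
    unfolding generalized_eigenvalue_def eigenvalue_def by blast
  ultimately show ?thesis by blast
qed

end
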